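(* Let $a,b$ be positive integers. Run Algorithm FindRegular on the input $(a,R;\,b,B)$, where $R$ is a fragment consisting of a single red bead and $B$ is a fragment consisting of a single black bead. Then the algorithm terminates and its output is a regular configuration in $\mathrm{CONF}(a,b)$.
   Context: For nonnegative integers $a,b$, $\mathrm{CONF}(a,b)$ denotes the set of necklaces, i.e. circular arrangements up to rotation, of $a$ red beads and $b$ black beads. For $\Delta\in\mathrm{CONF}(a,b)$ with $b>0$, label the black beads $B_0,\dots,B_{b-1}$ consecutively around the circle and let $x_i$ be the number of red beads between $B_i$ and $B_{i+1}$ (indices mod $b$). The sequence $\{x_0,\dots,x_{b-1}\}$ is a characteristic sequence of $\Delta$; it satisfies $x_0+\dots+x_{b-1}=a$ and is determined by $\Delta$ up to cyclic shift. Conversely, every sequence of nonnegative integers with sum $a$ determines a configuration. $\Delta$ is called regular if its characteristic sequence satisfies $\frac{a}{b}k-1 < x_i+x_{i+1}+\dots+x_{i+k-1} < \frac{a}{b}k+1$ for all $0\le i\le b-1$ and $1\le k\le 1+\lfloor b/2\rfloor$, with indices taken mod $b$. This condition is invariant under cyclic shifts. Algorithm FindRegular$(a,X;\,b,Y)$ takes positive integers $a,b$ and fragments $X,Y$, which are finite linear sequences of beads. It outputs a necklace made of $a$ copies of $X$ and $b$ copies of $Y$, as follows. If $a<b$, return FindRegular$(b,Y;\,a,X)$. Otherwise, write $a=bt+k$ with $t\ge 1$ and $0\le k<b$, and form the new fragment $Z$ consisting of $Y$ followed by $t$ copies of $X$. If $k\neq 0$, return FindRegular$(b,Z;\,k,X)$.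 If $k=0$, return the necklace formed by concatenating $b$ copies of $Z$ cyclically. *)

theory Defs
  imports Complex_Main
begin

datatype bead = Red | Black

definition necklace :: "bead list \<Rightarrow> bead list set" where
  "necklace w = range (\<lambda>n. rotate n w)"

definition CONF :: "nat \<Rightarrow> nat \<Rightarrow> bead list set set" where
  "CONF a b = {necklace w |w. count_list w Red = a \<and> count_list w Black = b}"

text \<open>Reading the circle from the black bead \<open>B\<^sub>0\<close> onwards, the bead \<open>B\<^sub>i\<close> is followed by
  \<open>x\<^sub>i\<close> red beads and then by \<open>B\<^sub>i\<^sub>+\<^sub>1\<close>, cyclically.\<close>

definition char_seq :: "bead list set \<Rightarrow> nat list \<Rightarrow> bool" where
  "char_seq \<Delta> xs \<longleftrightarrow>
     xs \<noteq> [] \<and> \<Delta> = necklace (concat (map (\<lambda>x. Black # replicate x Red) xs))"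

text \<open>A configuration having characteristic sequence \<open>xs\<close> lies in \<open>CONF a b\<close> exactly for
  \<open>a = sum_list xs\<close> and \<open>b = length xs\<close>. Characteristic sequences are unique up to cyclic shift
  and the condition is invariant under cyclic shifts, so it does not matter which one is used.\<close>

definition regular :: "bead list set \<Rightarrow> bool" where
  "regular \<Delta> \<longleftrightarrow> (\<exists>xs. char_seq \<Delta> xs \<and>
     (let a = sum_list xs; b = length xs in
       \<forall>i<b. \<forall>k\<in>{1..1 + b div 2}.
         real a / real b * real k - 1 < real (\<Sum>j<k. xs ! ((i + j) mod b)) \<and>
         real (\<Sum>j<k. xs ! ((i + j) mod b)) < real a / real b * real k + 1))"

text \<open>No termination proof is given here: the function is partial, and \<open>find_regular_dom\<close>, the
  accessible part of its recursive-call relation, is the set of inputs on which it terminates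
  (for instance, \<open>a > 0\<close> and \<open>b = 0\<close> leads to infinite recursion).\<close>

function (domintros) find_regular :: "nat \<Rightarrow> bead list \<Rightarrow> nat \<Rightarrow> bead list \<Rightarrow> bead list set" where
  "find_regular a X b Y =
     (if a < b then find_regular b Y a X
      else let t = a div b; k = a mod b; Z = Y @ concat (replicate t X) in
        if k \<noteq> 0 then find_regular b Z k X
        else necklace (concat (replicate b Z)))"
  by pat_completeness auto

end

theory Submission imports Defs begin

text \<open>Walk around the necklace with a step \<open>+b\<close> for every red and \<open>-a\<close> for every black bead. If
  all heights visited lie in a window of \<open>a + b\<close> consecutive integers, then the heights at which
  a black bead starts lie in a window of \<open>b\<close> integers, because after a black bead the walk is
  still in the large window. As \<open>k\<close> consecutive gaps with \<open>S\<close> red beads change the height by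
  \<open>b S - a k\<close>, this gives \<open>\<bar>b S - a k\<bar> < b\<close>, which is regularity.

  The window property is preserved by the Euclidean step: for \<open>a = b t + k\<close> the fragment \<open>Y X\<^sup>t\<close>
  has height \<open>-a + b t = -k\<close>, so a word in \<open>Y X\<^sup>t\<close> and \<open>X\<close> is the same kind of walk for the
  parameters \<open>(b, k)\<close> up to sign, and expanding the fragments enlarges the window downwards by
  at most \<open>b t\<close>.\<close>

section \<open>Bead words as integer walks\<close>

fun weight :: "int \<Rightarrow> int \<Rightarrow> bead \<Rightarrow> int" where
  "weight p q Red = p"
| "weight p q Black = q"

definition height :: "int \<Rightarrow> int \<Rightarrow> bead list \<Rightarrow> int" where
  "height p q w = sum_list (map (weight p q) w)"

fun walk_within :: "int \<Rightarrow> int \<Rightarrow> int \<Rightarrow> int \<Rightarrow> int \<Rightarrow> bead list \<Rightarrow> bool" where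
  "walk_within lo hi p q d [] \<longleftrightarrow> lo \<le> d \<and> d \<le> hi"
| "walk_within lo hi p q d (c # w) \<longleftrightarrow>
     lo \<le> d \<and> d \<le> hi \<and> walk_within lo hi p q (d + weight p q c) w"

text \<open>\<open>lo\<close> and \<open>d\<close> are existential because reflection, rotation and
  expansion shift the window and the starting height; only the window size of \<open>a + b\<close>
  integers matters.\<close>

definition balanced :: "nat \<Rightarrow> nat \<Rightarrow> bead list \<Rightarrow> bool" where
  "balanced a b w \<longleftrightarrow> count_list w Red = a \<and> count_list w Black = b \<and>
     (\<exists>lo d. walk_within lo (lo + int a + int b - 1) (int b) (- int a) d w)"

lemma height_simps [simp]:
  "height p q [] = 0"
  "height p q (c # w) = weight p q c + height p q w"
  "height p q (v @ w) = height p q v + height p q w"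
  by (simp_all add: height_def)

lemma height_replicate [simp]: "height p q (replicate n c) = int n * weight p q c"
  by (simp add: height_def sum_list_replicate)

lemma height_count_list:
  "height p q w = p * int (count_list w Red) + q * int (count_list w Black)"
proof (induction w)
  case (Cons c w)
  then show ?case by (cases c) (simp_all add: algebra_simps)
qed simp

lemma walk_within_start: "walk_within lo hi p q d w \<Longrightarrow> lo \<le> d \<and> d \<le> hi"
  by (cases w) auto

lemma walk_within_append:
  "walk_within lo hi p q d (v @ w) \<longleftrightarrow>
     walk_within lo hi p q d v \<and> walk_within lo hi p q (d + height p q v) w"
  by (induction v arbitrary: d) (auto simp: add.assoc dest: walk_within_start)

lemma walk_within_replicate_Red:
  assumes "p \<ge> 0" "lo \<le> d" "d + int n * p \<le> hi"
  shows "walk_within lo hi p q d (replicate n Red)"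
  using assms
proof (induction n arbitrary: d)
  case (Suc n)
  have "walk_within lo hi p q (d + p) (replicate n Red)"
    using Suc.prems by (intro Suc.IH) (simp_all add: algebra_simps)
  with walk_within_start[OF this] Suc.prems show ?case by simp
qed simp

lemma walk_within_uminus:
  "walk_within lo hi p q d w \<Longrightarrow> walk_within (- hi) (- lo) (- p) (- q) (- d) w"
proof (induction w arbitrary: d)
  case (Cons c w)
  then have "walk_within (- hi) (- lo) (- p) (- q) (- (d + weight p q c)) w"
    by (intro Cons.IH) simp
  with Cons.prems show ?case by (cases c) simp_all
qed simp

section \<open>Colour swap and Euclidean expansion\<close>

fun swap_bead :: "bead \<Rightarrow> bead" where
  "swap_bead Red = Black"
| "swap_bead Black = Red"

lemma walk_within_swap:
  "walk_within lo hi p q d (map swap_bead w) \<longleftrightarrow> walk_within lo hi q p d w"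
proof (induction w arbitrary: d)
  case (Cons c w)
  then show ?case by (cases c) simp_all
qed simp

lemma count_list_swap:
  "count_list (map swap_bead w) Red = count_list w Black \<and>
   count_list (map swap_bead w) Black = count_list w Red"
proof (induction w)
  case (Cons c w)
  then show ?case by (cases c) simp_all
qed simp

text \<open>Reflecting the walk keeps the window size. Reversed signs are the form needed both for
  swapping colours and for expanding fragments.\<close>

lemma balanced_uminus:
  assumes "balanced a b w"
  obtains lo d where "walk_within lo (lo + int a + int b - 1) (- int b) (int a) d w"
proof -
  obtain lo d where "walk_within lo (lo + int a + int b - 1) (int b) (- int a) d w"
    using assms by (auto simp: balanced_def)
  from walk_within_uminus[OF this] show thesis
    by (intro that[of "- (lo + int a + int b - 1)" "- d"]) simp
qed

lemma balanced_swap: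
  assumes "balanced a b w"
  shows "balanced b a (map swap_bead w)"
proof -
  obtain lo d where "walk_within lo (lo + int a + int b - 1) (- int b) (int a) d w"
    using assms by (rule balanced_uminus)
  then have "walk_within lo (lo + int b + int a - 1) (int a) (- int b) d (map swap_bead w)"
    by (simp add: walk_within_swap add.commute add.left_commute)
  with assms show ?thesis
    by (auto simp: balanced_def count_list_swap)
qed

fun expand_bead :: "nat \<Rightarrow> bead \<Rightarrow> bead list" where
  "expand_bead t Red = Black # replicate t Red"
| "expand_bead t Black = [Red]"

lemma count_list_replicate: "count_list (replicate n c) d = (if c = d then n else 0)"
  by (induction n) auto

lemma count_list_expand:
  "count_list (concat (map (expand_bead t) w)) Red =
     t * count_list w Red + count_list w Black \<and>
   count_list (concat (map (expand_bead t) w)) Black = count_list w Red"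
proof (induction w)
  case (Cons c w)
  then show ?case by (cases c) (simp_all add: count_list_replicate)
qed simp

text \<open>The block for a red bead drops from \<open>d\<close> to
  \<open>d + q = d - r - t * p\<close> and climbs back to \<open>d - r\<close> in steps of
  \<open>p\<close>. Since \<open>d - r\<close> is a height of the given walk, the block goes at most
  \<open>t * p\<close> below \<open>lo\<close>.\<close>

lemma walk_within_expand:
  assumes "p \<ge> 0" and "q \<le> 0" and "q + int t * p = - r" and "r \<ge> 0"
    and "walk_within lo hi (- r) p d w"
  shows "walk_within (lo - int t * p) hi p q d (concat (map (expand_bead t) w))"
  using assms(5)
proof (induction w arbitrary: d)
  case Nil
  have "0 \<le> int t * p" using assms by simp
  with Nil show ?case by simp
next
  case (Cons c w)
  have tp: "0 \<le> int t * p" using assms by simp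
  show ?case
  proof (cases c)
    case Red
    with Cons.prems have "lo \<le> d - r" by (auto dest: walk_within_start)
    with Red Cons tp assms(1-4) show ?thesis
      by (auto simp: walk_within_append add.assoc intro!: walk_within_replicate_Red)
  next
    case Black
    with Cons tp show ?thesis by simp
  qed
qed

lemma balanced_expand:
  assumes "balanced b k w" and "a = b * t + k"
  shows "balanced a b (concat (map (expand_bead t) w))"
proof -
  have a: "int a = int t * int b + int k"
    using assms(2) by simp
  obtain lo d where "walk_within lo (lo + int b + int k - 1) (- int k) (int b) d w"
    using assms(1) by (rule balanced_uminus)
  then have "walk_within (lo - int t * int b) (lo + int b + int k - 1) (int b) (- int a) d
      (concat (map (expand_bead t) w))"
    using a by (intro walk_within_expand[where r = "int k"]) auto
  \<comment> \<open>The window of \<open>b + k\<close> integers grows by \<open>t * b\<close>,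
    giving exactly \<open>a + b\<close>.\<close>
  moreover have "lo + int b + int k - 1 = lo - int t * int b + int a + int b - 1"
    using a by simp
  ultimately have "\<exists>lo d. walk_within lo (lo + int a + int b - 1) (int b) (- int a) d
      (concat (map (expand_bead t) w))"
    by metis
  with assms show ?thesis
    by (simp add: balanced_def count_list_expand mult.commute)
qed

text \<open>This is the pattern of the final call, \<open>b\<close> copies of one fragment. Red
  beads have step 0 here, so the walk stays at height 0.\<close>

lemma balanced_replicate_Red:
  assumes "b > 0"
  shows "balanced b 0 (replicate b Red)"
proof -
  have "walk_within 0 (0 + int b + int 0 - 1) (int 0) (- int b) 0 (replicate b Red)"
    using assms by (intro walk_within_replicate_Red) auto
  then show ?thesis
    unfolding balanced_def by (intro conjI exI[of _ 0]) (simp_all add: count_list_replicate)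
qed

section \<open>Invariance under rotation\<close>

lemma balanced_rotate:
  assumes "balanced a b w"
  shows "balanced a b (rotate n w)"
proof (induction n)
  case (Suc n)
  have "balanced a b (rotate1 v)" if v: "balanced a b v" for v
  proof (cases v)
    case (Cons c u)
    from v obtain lo d where
      walk: "walk_within lo (lo + int a + int b - 1) (int b) (- int a) d v"
      by (auto simp: balanced_def)
    \<comment> \<open>The total height \<open>b * a - a * b\<close> vanishes, so the walk is closed
      and moving its first bead to the end visits the same heights.\<close>
    have "height (int b) (- int a) v = 0"
      using v by (simp add: height_count_list balanced_def)
    then have "weight (int b) (- int a) c + height (int b) (- int a) u = 0"
      by (simp add: Cons)
    then have "d + weight (int b) (- int a) c + height (int b) (- int a) u = d"
      by simp
    then have "walk_within lo (lo + int a + int b - 1) (int b) (- int a)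
        (d + weight (int b) (- int a) c) (rotate1 v)"
      using walk Cons walk_within_start by (fastforce simp: walk_within_append)
    with v show ?thesis
      by (auto simp: balanced_def Cons)
  qed (use v in simp)
  with Suc show ?case by simp
qed (use assms in simp)

lemma necklace_rotate: "necklace (rotate n w) = necklace w"
proof
  show "necklace (rotate n w) \<subseteq> necklace w"
    by (auto simp: necklace_def rotate_rotate)
next
  have "rotate m w \<in> necklace (rotate n w)" for m
  proof (cases "w = []")
    case False
    then obtain l where l: "length w = Suc l" by (cases w) auto
    \<comment> \<open>Rotating by \<open>l * n\<close> undoes the rotation by \<open>n\<close>,
      because together they make \<open>n\<close> full turns.\<close>
    have "rotate (m + l * n) (rotate n w) = rotate (m + length w * n) w"
      by (simp add: rotate_rotate l algebra_simps)
    also have "\<dots> = rotate m w"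
      by (metis mod_mult_self2 rotate_conv_mod)
    finally show ?thesis
      unfolding necklace_def by (metis rangeI)
  qed (simp add: necklace_def)
  then show "necklace w \<subseteq> necklace (rotate n w)"
    by (auto simp: necklace_def)
qed

section \<open>Outputs of the algorithm as filled patterns\<close>

fun fill :: "bead list \<Rightarrow> bead list \<Rightarrow> bead \<Rightarrow> bead list" where
  "fill X Y Red = X"
| "fill X Y Black = Y"

lemma concat_fill_swap:
  "concat (map (fill X Y) (map swap_bead w)) = concat (map (fill Y X) w)"
proof (induction w)
  case (Cons c w)
  then show ?case by (cases c) simp_all
qed simp

text \<open>In the pattern of a recursive call, red stands for \<open>Y\<close> followed by
  \<open>t\<close> copies of \<open>X\<close>, and black for \<open>X\<close>. Expanding the pattern
  re-expresses the same output in the fragments of the calling level.\<close>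

lemma concat_fill_expand:
  "concat (map (fill X Y) (concat (map (expand_bead t) w))) =
     concat (map (fill (Y @ concat (replicate t X)) X) w)"
proof (induction w)
  case (Cons c w)
  then show ?case by (cases c) (simp_all add: map_replicate_const)
qed simp

lemma concat_fill_beads: "concat (map (fill [Red] [Black]) w) = w"
proof (induction w)
  case (Cons c w)
  then show ?case by (cases c) simp_all
qed simp

text \<open>The remainder \<open>k < b\<close> is the next second count, so strong induction on
  \<open>b\<close> applies, and the ordering of the counts persists: the swapping branch is not
  reached again. The fragments vary from call to call, hence \<open>arbitrary\<close>.\<close>

lemma find_regular_balanced_le:
  assumes "0 < b" and "b \<le> a"
  shows "find_regular_dom (a, X, b, Y) \<and>
    (\<exists>w. balanced a b w \<and> find_regular a X b Y = necklace (concat (map (fill X Y) w)))"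
  using assms
proof (induction b arbitrary: a X Y rule: less_induct)
  case (less b)
  define t k Z where "t = a div b" and "k = a mod b" and "Z = Y @ concat (replicate t X)"
  have a: "a = b * t + k" and "k < b"
    using less.prems by (simp_all add: t_def k_def)
  have rec: "find_regular_dom (b, Z, k, X) \<and>
    (\<exists>w. balanced b k w \<and> find_regular b Z k X = necklace (concat (map (fill Z X) w)))"
    if "k \<noteq> 0"
    using less.IH[of k b Z X] that \<open>k < b\<close> by simp
  have dom: "find_regular_dom (a, X, b, Y)"
    using less.prems rec by (rule_tac find_regular.domintros) (simp_all add: t_def k_def Z_def)
  have eq: "find_regular a X b Y =
      (if k \<noteq> 0 then find_regular b Z k X else necklace (concat (replicate b Z)))"
    using less.prems by (simp add: find_regular.psimps[OF dom] t_def k_def Z_def Let_def)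
  obtain w where "balanced b k w" and "find_regular a X b Y = necklace (concat (map (fill Z X) w))"
  proof (cases "k = 0")
    case True
    with less.prems show ?thesis
      by (intro that[of "replicate b Red"])
        (simp_all add: eq balanced_replicate_Red map_replicate_const)
  next
    case False
    with rec eq that show ?thesis by auto
  qed
  then have "balanced a b (concat (map (expand_bead t) w)) \<and> find_regular a X b Y =
      necklace (concat (map (fill X Y) (concat (map (expand_bead t) w))))"
    using a by (simp only: balanced_expand concat_fill_expand Z_def)
  with dom show ?case by blast
qed

lemma find_regular_balanced:
  assumes "0 < a" and "0 < b"
  shows "find_regular_dom (a, X, b, Y) \<and>
    (\<exists>w. balanced a b w \<and> find_regular a X b Y = necklace (concat (map (fill X Y) w)))"
proof (cases "a < b")
  case True
  then obtain w where dom': "find_regular_dom (b, Y, a, X)" and w: "balanced b a w"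
    and eq: "find_regular b Y a X = necklace (concat (map (fill Y X) w))"
    using find_regular_balanced_le[of a b Y X] assms by auto
  have dom: "find_regular_dom (a, X, b, Y)"
    using True dom' by (rule_tac find_regular.domintros) simp_all
  have "find_regular a X b Y = necklace (concat (map (fill X Y) (map swap_bead w)))"
    unfolding concat_fill_swap using True eq by (simp add: find_regular.psimps[OF dom])
  with dom balanced_swap[OF w] show ?thesis by blast
next
  case False
  with assms show ?thesis by (intro find_regular_balanced_le) simp_all
qed

section \<open>From the window to regularity\<close>

abbreviation gap_word :: "nat list \<Rightarrow> bead list" where
  "gap_word xs \<equiv> concat (map (\<lambda>x. Black # replicate x Red) xs)"

lemma ex_gap_word: "\<exists>x xs. w = replicate x Red @ gap_word xs"
proof (induction w)
  case Nil
  have "[] = replicate 0 Red @ gap_word []" by simp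
  then show ?case by blast
next
  case (Cons c w)
  then obtain x xs where w: "w = replicate x Red @ gap_word xs" by blast
  have "Red # w = replicate (Suc x) Red @ gap_word xs"
    and "Black # w = replicate 0 Red @ gap_word (x # xs)"
    using w by simp_all
  then show ?case by (cases c) blast+
qed

lemma count_list_gap_word:
  "count_list (gap_word xs) Red = sum_list xs \<and> count_list (gap_word xs) Black = length xs"
  by (induction xs) (simp_all add: count_list_replicate)

lemma gap_word_split:
  "j < length xs \<Longrightarrow>
     gap_word xs = gap_word (take j xs) @ Black # replicate (xs ! j) Red @ gap_word (drop (Suc j) xs)"
  by (subst id_take_nth_drop[of j xs]) simp_all

lemma balanced_gap_word_sums:
  assumes bal: "balanced a b (gap_word xs)" and i: "i < length xs"
  shows "\<bar>int b * (\<Sum>j<k. int (xs ! ((i + j) mod b))) - int a * int k\<bar> < int b"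
proof -
  have a: "a = sum_list xs" and b: "b = length xs"
    using bal by (simp_all add: balanced_def count_list_gap_word)
  have "b > 0" using i b by linarith
  obtain lo d where walk:
    "walk_within lo (lo + int a + int b - 1) (int b) (- int a) d (gap_word xs)"
    using bal by (auto simp: balanced_def)
  define P where "P j = d + height (int b) (- int a) (gap_word (take j xs))" for j
  \<comment> \<open>The black bead starting at \<open>P j\<close> leads to \<open>P j - a\<close>,
    which must still be at least \<open>lo\<close>; this cuts the possible values of
    \<open>P j\<close> down to \<open>b\<close> integers.\<close>
  have P_range: "lo + int a \<le> P j \<and> P j < lo + int a + int b" if "j < b" for j
  proof -
    have "walk_within lo (lo + int a + int b - 1) (int b) (- int a) (P j)
        (Black # replicate (xs ! j) Red @ gap_word (drop (Suc j) xs))"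
      using walk that unfolding gap_word_split[OF that[unfolded b]] walk_within_append P_def
      by blast
    then show ?thesis by (auto dest: walk_within_start)
  qed
  have P_Suc: "P (Suc j) = P j + int b * int (xs ! j) - int a" if "j < b" for j
    using that by (simp add: P_def take_Suc_conv_app_nth b algebra_simps)
  \<comment> \<open>\<open>P b\<close> is the height at the end of the word. Closedness of the walk
    lets the indices wrap modulo \<open>b\<close>, so that the gap sums telescope.\<close>
  have P_b: "P b = P 0"
    using count_list_gap_word[of xs] by (simp add: P_def height_count_list a b)
  have P_mod: "P (Suc n mod b) = P (n mod b) + int b * int (xs ! (n mod b)) - int a" for n
  proof -
    have "P (Suc n mod b) = P (Suc (n mod b))"
      using P_b by (auto simp: mod_Suc)
    with P_Suc[of "n mod b"] \<open>b > 0\<close> show ?thesis by simp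
  qed
  have "int b * (\<Sum>j<k. int (xs ! ((i + j) mod b))) - int a * int k = P ((i + k) mod b) - P (i mod b)"
  proof (induction k)
    case (Suc k)
    with P_mod[of "i + k"] show ?case by (simp add: algebra_simps)
  qed simp
  with P_range[of "(i + k) mod b"] P_range[of "i mod b"] \<open>b > 0\<close> show ?thesis
    by (simp add: abs_less_iff)
qed

lemma regular_necklace_gap_word:
  assumes "balanced a b (gap_word xs)" and "b > 0"
  shows "regular (necklace (gap_word xs))"
proof -
  have a: "sum_list xs = a" and b: "length xs = b"
    using assms by (simp_all add: balanced_def count_list_gap_word)
  have "real a / real b * real k - 1 < real (\<Sum>j<k. xs ! ((i + j) mod b)) \<and>
        real (\<Sum>j<k. xs ! ((i + j) mod b)) < real a / real b * real k + 1" if "i < b" for i k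
  proof -
    define S where "S = (\<Sum>j<k. xs ! ((i + j) mod b))"
    have "\<bar>int b * int S - int a * int k\<bar> < int b"
      using balanced_gap_word_sums[OF assms(1), of i k] that b by (simp add: S_def)
    then have "real_of_int \<bar>int b * int S - int a * int k\<bar> < real_of_int (int b)"
      by (simp only: of_int_less_iff)
    then have "\<bar>real b * real S - real a * real k\<bar> < real b"
      by simp
    with \<open>b > 0\<close> show ?thesis
      unfolding S_def[symmetric] by (simp add: field_simps abs_less_iff)
  qed
  moreover have "char_seq (necklace (gap_word xs)) xs"
    using assms(2) b by (auto simp: char_seq_def)
  ultimately show ?thesis
    unfolding regular_def by (intro exI[of _ xs]) (simp add: a b Let_def)
qed

lemma regular_necklace_balanced:
  assumes "balanced a b w" and "b > 0"
  shows "regular (necklace w)"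
proof -
  have "Black \<in> set w"
    using assms by (metis balanced_def count_notin less_numeral_extra(3))
  then obtain u v where w: "w = u @ Black # v" by (auto simp: in_set_conv_decomp)
  \<comment> \<open>Rotating the chosen black bead to the front leaves \<open>v @ u\<close> behind
    it; the leading red run of \<open>v @ u\<close> becomes the first gap.\<close>
  obtain x xs where "v @ u = replicate x Red @ gap_word xs"
    using ex_gap_word by blast
  then have "rotate (length u) w = gap_word (x # xs)"
    by (simp add: w rotate_append)
  with assms balanced_rotate[of a b w "length u"] regular_necklace_gap_word[of a b "x # xs"]
  show ?thesis by (metis necklace_rotate)
qed

theorem theorem1:
  fixes a b :: nat
  assumes "a > 0" and "b > 0"
  shows "find_regular_dom (a, [Red], b, [Black]) \<and>
         find_regular a [Red] b [Black] \<in> CONF a b \<and>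
         regular (find_regular a [Red] b [Black])"
proof -
  obtain w where dom: "find_regular_dom (a, [Red], b, [Black])" and w: "balanced a b w"
    and eq: "find_regular a [Red] b [Black] = necklace w"
    using find_regular_balanced[OF assms, of "[Red]" "[Black]"] by (auto simp: concat_fill_beads)
  have "necklace w \<in> CONF a b"
    using w by (auto simp: CONF_def balanced_def)
  with dom eq regular_necklace_balanced[OF w assms(2)] show ?thesis by simp
qed

end
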